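(* Let $G$ be an abelian group and let $L$ be a graded subalgebra of a $G$-graded Lie algebra $Q=\bigoplus_{\sigma\in G}Q_\sigma$ (over a unital commutative ring $\Phi$). Consider the following conditions: (i) $Q$ is an algebra of quotients of $L$. (ii) $Q$ is a graded algebra of quotients of $L$. Then (i) implies (ii). Moreover, if $L$ is graded semiprime, then (ii) implies (i).
   Context: A Lie algebra $L$ is $G$-graded if $L=\bigoplus_{\sigma\in G}L_\sigma$ with $[L_\sigma,L_\tau]\subseteq L_{\sigma\tau}$; a graded subalgebra $L$ of $Q$ satisfies $L=\bigoplus_\sigma (L\cap Q_\sigma)$, and $L_\sigma=L\cap Q_\sigma$. For a subalgebra $L$ of $Q$ and $q\in Q$, ${}_L(q)$ denotes the linear span in $Q$ of $q$ and all elements $\mathrm{ad}_{x_1}\cdots\mathrm{ad}_{x_n}q$ with $n\in\mathbb N$, $x_1,\dots,x_n\in L$, where $\mathrm{ad}_x(y)=[x,y]$. $Q$ is an algebra of quotients of $L$ if for all $p,q\in Q$ with $p\neq0$ there is $x\in L$ with $[x,p]\neq0$ and $[x,{}_L(q)]\subseteq L$. $Q$ is a graded algebra of quotients of $L$ if for all $\sigma,\tau\in G$, $0\neq p_\sigma\in Q_\sigma$ and $q_\tau\in Q_\tau$ there exist $\alpha\in G$ and $x_\alpha\in L_\alpha$ with $[x_\alpha,p_\sigma]\neq0$ and $[x_\alpha,{}_L(q_\tau)]\subseteq L$. A graded ideal is an ideal containing all homogeneous components of its elements. $L$ is graded semiprime if $[I,I]\neq0$ for every nonzero graded ideal $I$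 of $L$. *)

theory Defs
  imports Main "HOL.Modules"
begin

text \<open>The Lie algebra \<open>Q\<close> is the whole type \<open>'q\<close>; subalgebras and ideals are
  subsets of it. In \<open>HOL.Modules\<close>, \<open>subspace\<close> means submodule.\<close>

locale lie_algebra = module scale
  for scale :: "'r::comm_ring_1 \<Rightarrow> 'q::ab_group_add \<Rightarrow> 'q" (infixr "*s" 75) +
  fixes bracket :: "'q \<Rightarrow> 'q \<Rightarrow> 'q"
  assumes bracket_add_left: "bracket (x + y) z = bracket x z + bracket y z"
    and bracket_add_right: "bracket x (y + z) = bracket x y + bracket x z"
    and bracket_scale_left: "bracket (c *s x) y = c *s bracket x y"
    and bracket_scale_right: "bracket x (c *s y) = c *s bracket x y"
    and bracket_self: "bracket x x = 0"
    and jacobi: "bracket x (bracket y z) + bracket y (bracket z x) + bracket z (bracket x y) = 0"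
begin

definition lie_subalgebra :: "'q set \<Rightarrow> bool" where
  "lie_subalgebra L \<longleftrightarrow> subspace L \<and> (\<forall>x\<in>L. \<forall>y\<in>L. bracket x y \<in> L)"

definition lie_ideal :: "'q set \<Rightarrow> 'q set \<Rightarrow> bool" where
  "lie_ideal L I \<longleftrightarrow> subspace I \<and> I \<subseteq> L \<and> (\<forall>x\<in>L. \<forall>y\<in>I. bracket x y \<in> I)"

definition bracket_span :: "'q set \<Rightarrow> 'q set \<Rightarrow> 'q set" where
  "bracket_span I J = span {bracket x y | x y. x \<in> I \<and> y \<in> J}"

text \<open>The submodule \<open>\<^sub>L(q)\<close>: for \<open>xs = [x\<^sub>1, \<dots>, x\<^sub>n]\<close> the generator is
  \<open>ad x\<^sub>1 (\<dots> (ad x\<^sub>n q))\<close>, and the empty list yields \<open>q\<close> itself.\<close>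

definition ad_span :: "'q set \<Rightarrow> 'q \<Rightarrow> 'q set" where
  "ad_span L q = span {foldr bracket xs q | xs. set xs \<subseteq> L}"

definition algebra_of_quotients :: "'q set \<Rightarrow> bool" where
  "algebra_of_quotients L \<longleftrightarrow>
    (\<forall>p q. p \<noteq> 0 \<longrightarrow>
      (\<exists>x\<in>L. bracket x p \<noteq> 0 \<and> (\<forall>y\<in>ad_span L q. bracket x y \<in> L)))"

end

definition decomposition ::
    "('g \<Rightarrow> 'q::ab_group_add set) \<Rightarrow> 'q \<Rightarrow> ('g \<Rightarrow> 'q) \<Rightarrow> bool" where
  "decomposition A x f \<longleftrightarrow>
    (\<forall>\<sigma>. f \<sigma> \<in> A \<sigma>) \<and> finite {\<sigma>. f \<sigma> \<noteq> 0} \<and> x = (\<Sum>\<sigma> | f \<sigma> \<noteq> 0. f \<sigma>)"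

text \<open>Only meaningful when \<open>x\<close> has a unique decomposition along \<open>A\<close>.\<close>

definition component :: "('g \<Rightarrow> 'q::ab_group_add set) \<Rightarrow> 'q \<Rightarrow> 'g \<Rightarrow> 'q" where
  "component A x = (THE f. decomposition A x f)"

context module
begin

definition is_direct_sum :: "'b set \<Rightarrow> ('g \<Rightarrow> 'b set) \<Rightarrow> bool" where
  "is_direct_sum V A \<longleftrightarrow>
    subspace V \<and> (\<forall>\<sigma>. subspace (A \<sigma>) \<and> A \<sigma> \<subseteq> V) \<and> (\<forall>x\<in>V. \<exists>!f. decomposition A x f)"

end

text \<open>The abelian grading group is written additively.\<close>

locale graded_lie_algebra = lie_algebra scale bracket
  for scale :: "'r::comm_ring_1 \<Rightarrow> 'q::ab_group_add \<Rightarrow> 'q" (infixr "*s" 75)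
    and bracket :: "'q \<Rightarrow> 'q \<Rightarrow> 'q" +
  fixes Q :: "'g::ab_group_add \<Rightarrow> 'q set"
  assumes direct_sum: "is_direct_sum UNIV Q"
    and bracket_graded: "x \<in> Q \<sigma> \<Longrightarrow> y \<in> Q \<tau> \<Longrightarrow> bracket x y \<in> Q (\<sigma> + \<tau>)"
begin

definition graded_subalgebra :: "'q set \<Rightarrow> bool" where
  "graded_subalgebra L \<longleftrightarrow> lie_subalgebra L \<and> is_direct_sum L (\<lambda>\<sigma>. L \<inter> Q \<sigma>)"

definition graded_ideal :: "'q set \<Rightarrow> 'q set \<Rightarrow> bool" where
  "graded_ideal L I \<longleftrightarrow>
    lie_ideal L I \<and> (\<forall>y\<in>I. \<forall>\<sigma>. component (\<lambda>\<sigma>. L \<inter> Q \<sigma>) y \<sigma> \<in> I)"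

definition graded_semiprime :: "'q set \<Rightarrow> bool" where
  "graded_semiprime L \<longleftrightarrow> (\<forall>I. graded_ideal L I \<and> I \<noteq> {0} \<longrightarrow> bracket_span I I \<noteq> {0})"

definition graded_algebra_of_quotients :: "'q set \<Rightarrow> bool" where
  "graded_algebra_of_quotients L \<longleftrightarrow>
    (\<forall>\<sigma> \<tau>. \<forall>p\<in>Q \<sigma>. \<forall>q\<in>Q \<tau>. p \<noteq> 0 \<longrightarrow>
      (\<exists>\<alpha>. \<exists>x\<in>L \<inter> Q \<alpha>. bracket x p \<noteq> 0 \<and> (\<forall>y\<in>ad_span L q. bracket x y \<in> L)))"

end

end

theory Submission
  imports Defs
begin

text \<open>For \<open>q\<close> in \<open>Q\<close> let \<open>(L : q)\<close> be the set of \<open>x \<in> L\<close> with \<open>[x, \<^sub>L(q)] \<subseteq> L\<close>; it is an ideal of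
  \<open>L\<close>, and a graded one if \<open>q\<close> is homogeneous. Gradedness gives (i) \<open>\<Longrightarrow>\<close> (ii): some homogeneous
  component of \<open>x\<close> still moves \<open>p\<close>. For the converse, call a graded ideal of \<open>L\<close> dense if no
  nonzero homogeneous element of \<open>L\<close> annihilates it. By (ii) each \<open>(L : q)\<close> with \<open>q\<close> homogeneous
  is dense, and graded semiprimeness makes the intersection of two dense ideals dense. For
  arbitrary \<open>q\<close>, the intersection of the \<open>(L : q\<^sub>\<tau>)\<close> is therefore dense and lies in \<open>(L : q)\<close>. By
  (ii) again, a nonzero homogeneous element of \<open>Q\<close> annihilating it could be moved into \<open>L\<close>,
  so the intersection has no nonzero annihilator in \<open>Q\<close>.\<close>

section \<open>Bracket identities and Lie ideals, without the grading\<close>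

context lie_algebra
begin

lemma bracket_zero_left [simp]: "bracket 0 y = 0"
  using bracket_add_left[of 0 0 y] by simp

lemma bracket_zero_right [simp]: "bracket x 0 = 0"
  using bracket_add_right[of x 0 0] by simp

lemma bracket_minus_right: "bracket x (- y) = - bracket x y"
  using bracket_add_right[of x y "- y"] by (simp add: eq_neg_iff_add_eq_0 add.commute)

lemma bracket_anticomm: "bracket x y = - bracket y x"
  using bracket_self[of "x + y", unfolded bracket_add_left bracket_add_right]
  by (simp add: bracket_self eq_neg_iff_add_eq_0 add.commute)

lemma bracket_sum_left: "bracket (\<Sum>a\<in>A. f a) y = (\<Sum>a\<in>A. bracket (f a) y)"
  by (induction A rule: infinite_finite_induct) (auto simp: bracket_add_left)

lemma bracket_sum_right: "bracket x (\<Sum>a\<in>A. f a) = (\<Sum>a\<in>A. bracket x (f a))"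
  by (induction A rule: infinite_finite_induct) (auto simp: bracket_add_right)

text \<open>The Jacobi identity rearranged by anticommutativity: each \<open>bracket x\<close> is a
  derivation. The later ideal arguments use Jacobi in this form.\<close>

lemma bracket_derivation:
  "bracket x (bracket y z) = bracket (bracket x y) z + bracket y (bracket x z)"
proof -
  have "bracket y (bracket z x) = - bracket y (bracket x z)"
    by (metis bracket_anticomm bracket_minus_right)
  moreover have "bracket z (bracket x y) = - bracket (bracket x y) z"
    by (rule bracket_anticomm)
  ultimately show ?thesis using jacobi[of x y z]
    by (simp add: algebra_simps)
qed

lemma lie_ideal_inter:
  "lie_ideal L I \<Longrightarrow> lie_ideal L J \<Longrightarrow> lie_ideal L (I \<inter> J)"
  unfolding lie_ideal_def by (auto simp: subspace_inter)

lemma lie_ideal_self: "lie_subalgebra L \<Longrightarrow> lie_ideal L L"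
  by (auto simp: lie_subalgebra_def lie_ideal_def)

lemma lie_ideal_bracket_right:
  assumes "lie_ideal L I" "x \<in> I" "y \<in> L"
  shows "bracket x y \<in> I"
  using assms bracket_anticomm[of x y] by (auto simp: lie_ideal_def subspace_neg)

lemma bracket_span_eq_zero:
  assumes "\<And>x y. x \<in> I \<Longrightarrow> y \<in> J \<Longrightarrow> bracket x y = 0"
  shows "bracket_span I J = {0}"
proof -
  have "bracket_span I J \<subseteq> {0}"
    unfolding bracket_span_def using assms
    by (intro span_minimal) (auto simp: subspace_single_0)
  then show ?thesis
    unfolding bracket_span_def using span_zero by blast
qed

section \<open>Annihilators of ideals\<close>

definition annihilator :: "'q set \<Rightarrow> 'q set \<Rightarrow> 'q set" where
  "annihilator L I = {y \<in> L. \<forall>x\<in>I. bracket x y = 0}"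

text \<open>In \<open>[z,[x,y]] = [[z,x],y] + [x,[z,y]]\<close> the first term vanishes because
  \<open>[z,x]\<close> is again in \<open>I\<close>, the second because \<open>y\<close> annihilates
  \<open>z\<close>.\<close>

lemma lie_ideal_annihilator:
  assumes L: "lie_subalgebra L" and I: "lie_ideal L I"
  shows "lie_ideal L (annihilator L I)"
  unfolding lie_ideal_def
proof (intro conjI ballI)
  show "subspace (annihilator L I)"
    using L by (auto simp: lie_subalgebra_def subspace_def annihilator_def bracket_add_right
        bracket_scale_right)
  show "annihilator L I \<subseteq> L" by (auto simp: annihilator_def)
next
  fix x y assume x: "x \<in> L" and y: "y \<in> annihilator L I"
  have "bracket z (bracket x y) = 0" if z: "z \<in> I" for z
    using y z lie_ideal_bracket_right[OF I z x] bracket_derivation[of z x y]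
    by (simp add: annihilator_def)
  then show "bracket x y \<in> annihilator L I"
    using x y L by (auto simp: annihilator_def lie_subalgebra_def)
qed

section \<open>The submodules \<open>ad_span L q\<close> and the ideals
  \<open>colon L q\<close>\<close>

lemma ad_span_base: "q \<in> ad_span L q"
  unfolding ad_span_def by (rule span_base) (auto intro!: exI[of _ "[]"])

lemma subspace_ad_span: "subspace (ad_span L q)"
  unfolding ad_span_def by simp

text \<open>Characterises \<open>ad_span L q\<close> as the least submodule containing
  \<open>q\<close> and stable under brackets with \<open>L\<close>, so that later proofs need not
  handle lists.\<close>

lemma ad_span_induct [consumes 1, case_names subspace base step]:
  assumes "y \<in> ad_span L q" and "subspace S" and "q \<in> S"
    and "\<And>x z. x \<in> L \<Longrightarrow> z \<in> ad_span L q \<Longrightarrow> z \<in> S \<Longrightarrow> bracket x z \<in> S"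
  shows "y \<in> S"
proof -
  have gen: "foldr bracket xs q \<in> S" if "set xs \<subseteq> L" for xs
    using that
  proof (induction xs)
    case (Cons x xs)
    then have "foldr bracket xs q \<in> ad_span L q"
      unfolding ad_span_def by (intro span_base) auto
    with Cons assms(4) show ?case by simp
  qed (use assms in simp)
  have "ad_span L q \<subseteq> S"
    unfolding ad_span_def using gen assms(2) by (intro span_minimal) auto
  with assms(1) show ?thesis by blast
qed

lemma bracket_ad_span:
  assumes x: "x \<in> L" and y: "y \<in> ad_span L q"
  shows "bracket x y \<in> ad_span L q"
proof -
  have "bracket x y \<in> ad_span L q"
    if "y \<in> span {foldr bracket xs q | xs. set xs \<subseteq> L}" for y
    using that
  proof (induction rule: span_induct_alt)
    case base
    then show ?case using subspace_ad_span by (simp add: subspace_0)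
  next
    case (step c g y)
    then obtain xs where "g = foldr bracket xs q" "set xs \<subseteq> L" by blast
    then have "bracket x g \<in> ad_span L q"
      unfolding ad_span_def using x by (intro span_base) (auto intro!: exI[of _ "x # xs"])
    with step show ?case
      by (simp add: bracket_add_right bracket_scale_right subspace_add subspace_scale
          subspace_ad_span)
  qed
  with y show ?thesis by (simp add: ad_span_def)
qed

text \<open>The witnesses required by \<open>algebra_of_quotients\<close> are exactly the members of
  this set that do not annihilate \<open>p\<close>; the graded notion asks for homogeneous
  ones.\<close>

definition colon :: "'q set \<Rightarrow> 'q \<Rightarrow> 'q set" where
  "colon L q = {x \<in> L. \<forall>y\<in>ad_span L q. bracket x y \<in> L}"

text \<open>In \<open>[[x,y],z] = [x,[y,z]] - [y,[x,z]]\<close> the last term lies in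
  \<open>L\<close> because \<open>[x,z]\<close> stays in \<open>ad_span L q\<close>. This is why the
  condition is imposed on all of \<open>ad_span L q\<close> and not on \<open>q\<close>
  alone.\<close>

lemma lie_ideal_colon:
  assumes L: "lie_subalgebra L"
  shows "lie_ideal L (colon L q)"
  unfolding lie_ideal_def
proof (intro conjI ballI)
  show "subspace (colon L q)"
    using L by (auto simp: lie_subalgebra_def subspace_def colon_def bracket_add_left
        bracket_scale_left)
  show "colon L q \<subseteq> L" by (auto simp: colon_def)
next
  fix x y assume x: "x \<in> L" and y: "y \<in> colon L q"
  have "bracket (bracket x y) z \<in> L" if z: "z \<in> ad_span L q" for z
  proof -
    have "bracket (bracket x y) z = bracket x (bracket y z) - bracket y (bracket x z)"
      using bracket_derivation[of x y z] by simp
    moreover have "bracket x (bracket y z) \<in> L" "bracket y (bracket x z) \<in> L"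
      using x y z L bracket_ad_span[OF x z] by (auto simp: colon_def lie_subalgebra_def)
    ultimately show ?thesis using L by (simp add: lie_subalgebra_def subspace_diff)
  qed
  then show "bracket x y \<in> colon L q"
    using x y L by (auto simp: colon_def lie_subalgebra_def)
qed

text \<open>Iterated brackets are additive in their last argument, so a generator for the sum is a
  sum of generators for the summands. For empty \<open>A\<close> only the separate hypothesis gives
  \<open>x \<in> L\<close>.\<close>

lemma colon_sum:
  assumes L: "lie_subalgebra L" and x: "x \<in> L"
    and colon: "\<And>a. a \<in> A \<Longrightarrow> x \<in> colon L (f a)"
  shows "x \<in> colon L (\<Sum>a\<in>A. f a)"
proof -
  have L0: "subspace L" using L by (simp add: lie_subalgebra_def)
  have foldr_sum: "foldr bracket xs (\<Sum>a\<in>A. f a) = (\<Sum>a\<in>A. foldr bracket xs (f a))" for xs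
    by (induction xs) (auto simp: bracket_sum_right)
  have gen: "bracket x (foldr bracket xs (\<Sum>a\<in>A. f a)) \<in> L" if "set xs \<subseteq> L" for xs
    unfolding foldr_sum bracket_sum_right
  proof (rule subspace_sum[OF L0])
    fix a assume "a \<in> A"
    moreover have "foldr bracket xs (f a) \<in> ad_span L (f a)"
      unfolding ad_span_def using that by (intro span_base) auto
    ultimately show "bracket x (foldr bracket xs (f a)) \<in> L"
      using colon by (auto simp: colon_def)
  qed
  have "subspace {y. bracket x y \<in> L}"
    using L0 by (auto simp: subspace_def bracket_add_right bracket_scale_right)
  then have "ad_span L (\<Sum>a\<in>A. f a) \<subseteq> {y. bracket x y \<in> L}"
    unfolding ad_span_def using gen by (intro span_minimal) auto
  with x show ?thesis by (auto simp: colon_def)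
qed

end

section \<open>Homogeneous components in \<open>Q\<close>\<close>

context graded_lie_algebra
begin

lemma subspace_Q: "subspace (Q \<sigma>)"
  using direct_sum by (simp add: is_direct_sum_def)

abbreviation hcomp :: "'q \<Rightarrow> 'g \<Rightarrow> 'q" where
  "hcomp \<equiv> component Q"

lemma ex1_decomposition: "\<exists>!f. decomposition Q x f"
  using direct_sum by (simp add: is_direct_sum_def)

lemma decomposition_comp: "decomposition Q x (hcomp x)"
  unfolding component_def by (rule theI'[OF ex1_decomposition])

lemma comp_eqI: "decomposition Q x f \<Longrightarrow> hcomp x = f"
  using ex1_decomposition decomposition_comp by blast

text \<open>\<open>decomposition\<close> sums over the exact support. Allowing any finite superset
  \<open>S\<close> avoids computing supports where cancellation may occur.\<close>

lemma comp_eqI_sum: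
  assumes "finite S" and "\<And>\<sigma>. f \<sigma> \<in> Q \<sigma>" and "\<And>\<sigma>. \<sigma> \<notin> S \<Longrightarrow> f \<sigma> = 0"
    and "x = (\<Sum>\<sigma>\<in>S. f \<sigma>)"
  shows "hcomp x = f"
proof (rule comp_eqI, unfold decomposition_def, intro conjI allI)
  have sub: "{\<sigma>. f \<sigma> \<noteq> 0} \<subseteq> S" using assms(3) by blast
  with assms(1) show "finite {\<sigma>. f \<sigma> \<noteq> 0}" by (rule finite_subset[rotated])
  show "x = (\<Sum>\<sigma> | f \<sigma> \<noteq> 0. f \<sigma>)"
    unfolding assms(4) using assms(1) sub by (intro sum.mono_neutral_right) auto
qed (rule assms(2))

lemma comp_in_Q: "hcomp x \<sigma> \<in> Q \<sigma>"
  using decomposition_comp by (auto simp: decomposition_def)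

lemma finite_support: "finite {\<sigma>. hcomp x \<sigma> \<noteq> 0}"
  using decomposition_comp by (auto simp: decomposition_def)

lemma sum_comp: "(\<Sum>\<sigma> | hcomp x \<sigma> \<noteq> 0. hcomp x \<sigma>) = x"
  using decomposition_comp by (auto simp: decomposition_def)

lemma sum_comp_superset:
  assumes "finite S" "{\<sigma>. hcomp x \<sigma> \<noteq> 0} \<subseteq> S"
  shows "(\<Sum>\<sigma>\<in>S. hcomp x \<sigma>) = x"
proof -
  have "(\<Sum>\<sigma>\<in>S. hcomp x \<sigma>) = (\<Sum>\<sigma> | hcomp x \<sigma> \<noteq> 0. hcomp x \<sigma>)"
    using assms by (intro sum.mono_neutral_right) auto
  then show ?thesis by (simp add: sum_comp)
qed

lemma comp_homogeneous:
  assumes "x \<in> Q \<sigma>"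
  shows "hcomp x = (\<lambda>\<tau>. if \<tau> = \<sigma> then x else 0)"
  using assms subspace_Q by (intro comp_eqI_sum[where S = "{\<sigma>}"]) (auto simp: subspace_0)

lemma comp_zero [simp]: "hcomp 0 \<sigma> = 0"
  using comp_homogeneous[of 0 \<sigma>] subspace_Q by (simp add: subspace_0)

lemma comp_add: "hcomp (x + y) \<sigma> = hcomp x \<sigma> + hcomp y \<sigma>"
proof -
  let ?S = "{\<sigma>. hcomp x \<sigma> \<noteq> 0} \<union> {\<sigma>. hcomp y \<sigma> \<noteq> 0}"
  have "hcomp (x + y) = (\<lambda>\<sigma>. hcomp x \<sigma> + hcomp y \<sigma>)"
    by (rule comp_eqI_sum[where S = ?S])
      (auto simp: finite_support sum.distrib sum_comp_superset comp_in_Q subspace_add subspace_Q)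
  then show ?thesis by simp
qed

lemma comp_scale: "hcomp (c *s x) \<sigma> = c *s hcomp x \<sigma>"
proof -
  have "hcomp (c *s x) = (\<lambda>\<sigma>. c *s hcomp x \<sigma>)"
    by (rule comp_eqI_sum[where S = "{\<sigma>. hcomp x \<sigma> \<noteq> 0}"])
      (auto simp: finite_support comp_in_Q subspace_scale subspace_Q sum_comp
        scale_sum_right[symmetric])
  then show ?thesis by simp
qed

lemma comp_minus: "hcomp (- x) \<sigma> = - hcomp x \<sigma>"
  using comp_add[of x "- x" \<sigma>] by (simp add: eq_neg_iff_add_eq_0 add.commute)

lemma comp_sum: "hcomp (\<Sum>a\<in>A. f a) \<sigma> = (\<Sum>a\<in>A. hcomp (f a) \<sigma>)"
  by (induction A rule: infinite_finite_induct) (auto simp: comp_add)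

text \<open>Bracketing with \<open>x\<close> shifts degrees by \<alpha>, so the brackets with the
  components of \<open>y\<close>, reindexed by this shift, decompose
  \<open>bracket x y\<close>.\<close>

lemma comp_bracket_homogeneous_left:
  assumes x: "x \<in> Q \<alpha>"
  shows "hcomp (bracket x y) (\<alpha> + \<sigma>) = bracket x (hcomp y \<sigma>)"
proof -
  have "hcomp (bracket x y) = (\<lambda>\<rho>. bracket x (hcomp y (\<rho> - \<alpha>)))"
  proof (rule comp_eqI_sum[where S = "(+) \<alpha> ` {\<sigma>. hcomp y \<sigma> \<noteq> 0}"])
    show "finite ((+) \<alpha> ` {\<sigma>. hcomp y \<sigma> \<noteq> 0})" using finite_support by blast
    show "bracket x (hcomp y (\<rho> - \<alpha>)) \<in> Q \<rho>" for \<rho>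
      using bracket_graded[OF x comp_in_Q[of y "\<rho> - \<alpha>"]] by simp
    show "bracket x (hcomp y (\<rho> - \<alpha>)) = 0" if "\<rho> \<notin> (+) \<alpha> ` {\<sigma>. hcomp y \<sigma> \<noteq> 0}" for \<rho>
    proof -
      \<comment> \<open>Outside the translated support, \<rho> - \<alpha> is outside the support of
        \<open>y\<close>.\<close>
      have "\<rho> = \<alpha> + (\<rho> - \<alpha>)" by simp
      with that have "hcomp y (\<rho> - \<alpha>) = 0" by blast
      then show ?thesis by simp
    qed
    have "bracket x y = (\<Sum>\<sigma> | hcomp y \<sigma> \<noteq> 0. bracket x (hcomp y \<sigma>))"
      by (metis bracket_sum_right sum_comp)
    then show "bracket x y
      = (\<Sum>\<rho>\<in>(+) \<alpha> ` {\<sigma>. hcomp y \<sigma> \<noteq> 0}. bracket x (hcomp y (\<rho> - \<alpha>)))"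
      by (simp add: sum.reindex)
  qed
  then show ?thesis by simp
qed

text \<open>Follows from the left version by anticommutativity; commutativity of the grading group
  makes the two degrees agree.\<close>

lemma comp_bracket_homogeneous_right:
  assumes "y \<in> Q \<sigma>"
  shows "hcomp (bracket x y) (\<alpha> + \<sigma>) = bracket (hcomp x \<alpha>) y"
proof -
  have "hcomp (bracket x y) (\<alpha> + \<sigma>) = - hcomp (bracket y x) (\<sigma> + \<alpha>)"
    by (metis add.commute bracket_anticomm comp_minus)
  also have "\<dots> = - bracket y (hcomp x \<alpha>)"
    by (simp add: comp_bracket_homogeneous_left[OF assms])
  finally show ?thesis by (metis bracket_anticomm)
qed

lemma comp_bracket:
  "hcomp (bracket x y) \<sigma> = (\<Sum>\<alpha> | hcomp x \<alpha> \<noteq> 0. bracket (hcomp x \<alpha>) (hcomp y (\<sigma> - \<alpha>)))"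
proof -
  have "hcomp (bracket x y) \<sigma> = (\<Sum>\<alpha> | hcomp x \<alpha> \<noteq> 0. hcomp (bracket (hcomp x \<alpha>) y) \<sigma>)"
    by (metis bracket_sum_left comp_sum sum_comp)
  moreover have "hcomp (bracket (hcomp x \<alpha>) y) \<sigma> = bracket (hcomp x \<alpha>) (hcomp y (\<sigma> - \<alpha>))" for \<alpha>
    using comp_bracket_homogeneous_left[OF comp_in_Q, of x \<alpha> y "\<sigma> - \<alpha>"] by simp
  ultimately show ?thesis by simp
qed

section \<open>Graded ideals via components in \<open>Q\<close>\<close>

definition comp_closed :: "'q set \<Rightarrow> bool" where
  "comp_closed S \<longleftrightarrow> (\<forall>y\<in>S. \<forall>\<sigma>. hcomp y \<sigma> \<in> S)"

lemma comp_closed_inter: "comp_closed S \<Longrightarrow> comp_closed T \<Longrightarrow> comp_closed (S \<inter> T)"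
  by (auto simp: comp_closed_def)

text \<open>A decomposition along \<open>L \<inter> Q \<sigma>\<close> is also one along
  \<open>Q\<close>, where decompositions are unique.\<close>

lemma component_subalgebra:
  assumes "graded_subalgebra L" "y \<in> L"
  shows "component (\<lambda>\<sigma>. L \<inter> Q \<sigma>) y = hcomp y"
proof -
  obtain f where f: "decomposition (\<lambda>\<sigma>. L \<inter> Q \<sigma>) y f"
      and uniq: "\<And>g. decomposition (\<lambda>\<sigma>. L \<inter> Q \<sigma>) y g \<Longrightarrow> g = f"
    using assms unfolding graded_subalgebra_def is_direct_sum_def by metis
  have "component (\<lambda>\<sigma>. L \<inter> Q \<sigma>) y = f"
    unfolding component_def using f uniq by (rule the_equality)
  moreover have "decomposition Q y f" using f by (auto simp: decomposition_def)
  ultimately show ?thesis using comp_eqI by simp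
qed

lemma comp_closed_subalgebra:
  assumes "graded_subalgebra L"
  shows "comp_closed L"
  unfolding comp_closed_def
proof (intro ballI allI)
  fix y \<sigma> assume y: "y \<in> L"
  have "\<exists>!f. decomposition (\<lambda>\<sigma>. L \<inter> Q \<sigma>) y f"
    using assms y by (simp add: graded_subalgebra_def is_direct_sum_def)
  from theI'[OF this] have "component (\<lambda>\<sigma>. L \<inter> Q \<sigma>) y \<sigma> \<in> L"
    by (simp add: component_def decomposition_def)
  then show "hcomp y \<sigma> \<in> L" by (simp add: component_subalgebra[OF assms y])
qed

text \<open>Replaces components relative to \<open>L\<close> by components in \<open>Q\<close>,
  which also make sense for \<open>ad_span L q\<close>, a set that may leave
  \<open>L\<close>.\<close>

lemma graded_ideal_iff:
  assumes "graded_subalgebra L"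
  shows "graded_ideal L I \<longleftrightarrow> lie_ideal L I \<and> comp_closed I"
proof -
  have "component (\<lambda>\<sigma>. L \<inter> Q \<sigma>) y = hcomp y" if "lie_ideal L I" "y \<in> I" for y
    using component_subalgebra[OF assms, of y] that by (auto simp: lie_ideal_def)
  then show ?thesis by (auto simp: graded_ideal_def comp_closed_def)
qed

lemma graded_ideal_inter:
  assumes "graded_subalgebra L" "graded_ideal L I" "graded_ideal L J"
  shows "graded_ideal L (I \<inter> J)"
  using assms by (simp add: graded_ideal_iff lie_ideal_inter comp_closed_inter)

text \<open>A homogeneous \<open>q\<close> has only the components \<open>q\<close> and 0. In the
  inductive step each component of \<open>[x,z]\<close> is a sum of brackets of components of
  \<open>x\<close>, which lie in \<open>L\<close>, with components of \<open>z\<close>.\<close>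

lemma comp_closed_ad_span:
  assumes L: "graded_subalgebra L" and q: "q \<in> Q \<tau>"
  shows "comp_closed (ad_span L q)"
  unfolding comp_closed_def
proof
  fix y assume "y \<in> ad_span L q"
  then have "y \<in> {y. \<forall>\<sigma>. hcomp y \<sigma> \<in> ad_span L q}"
  proof (induction rule: ad_span_induct)
    case subspace
    show ?case
      using subspace_ad_span[of L q]
      by (auto simp: subspace_def comp_add comp_scale)
  next
    case base
    show ?case
      using subspace_0[OF subspace_ad_span] by (auto simp: comp_homogeneous[OF q] ad_span_base)
  next
    case (step x z)
    then show ?case
      using comp_closed_subalgebra[OF L] subspace_ad_span
      by (auto simp: comp_bracket comp_closed_def intro!: subspace_sum bracket_ad_span)
  qed
  then show "\<forall>\<sigma>. hcomp y \<sigma> \<in> ad_span L q" by simp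
qed

text \<open>It suffices to test \<open>hcomp x \<alpha>\<close> on homogeneous elements of
  \<open>ad_span L q\<close>. For such an element of degree \<sigma>, the bracket is the component
  of degree \<alpha> + \<sigma> of an element of \<open>L\<close>.\<close>

lemma graded_ideal_colon:
  assumes L: "graded_subalgebra L" and q: "q \<in> Q \<tau>"
  shows "graded_ideal L (colon L q)"
proof -
  have L0: "lie_subalgebra L" and LS: "subspace L"
    using L by (auto simp: graded_subalgebra_def lie_subalgebra_def)
  have Lc: "comp_closed L" using comp_closed_subalgebra[OF L] .
  have "comp_closed (colon L q)"
    unfolding comp_closed_def
  proof (intro ballI allI)
    fix x \<alpha> assume x: "x \<in> colon L q"
    have "bracket (hcomp x \<alpha>) y \<in> L" if y: "y \<in> ad_span L q" for y
    proof -
      have "bracket (hcomp x \<alpha>) (hcomp y \<sigma>) \<in> L" for \<sigma>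
      proof -
        have "hcomp y \<sigma> \<in> ad_span L q"
          using comp_closed_ad_span[OF L q] y by (simp add: comp_closed_def)
        with x Lc have "hcomp (bracket x (hcomp y \<sigma>)) (\<alpha> + \<sigma>) \<in> L"
          by (simp add: colon_def comp_closed_def)
        then show ?thesis by (simp add: comp_bracket_homogeneous_right[OF comp_in_Q])
      qed
      then have "(\<Sum>\<sigma> | hcomp y \<sigma> \<noteq> 0. bracket (hcomp x \<alpha>) (hcomp y \<sigma>)) \<in> L"
        by (intro subspace_sum[OF LS])
      then show ?thesis by (simp add: bracket_sum_right[symmetric] sum_comp)
    qed
    then show "hcomp x \<alpha> \<in> colon L q"
      using x Lc by (simp add: colon_def comp_closed_def)
  qed
  then show ?thesis
    using lie_ideal_colon[OF L0] by (simp add: graded_ideal_iff[OF L])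
qed

text \<open>Since \<open>I\<close> contains the components of its elements,
  \<open>[hcomp x \<alpha>, y]\<close> vanishes for \<open>x\<close> in \<open>I\<close>, and so do
  its components \<open>[hcomp x \<alpha>, hcomp y \<sigma>]\<close>.\<close>

lemma graded_ideal_annihilator:
  assumes L: "graded_subalgebra L" and I: "graded_ideal L I"
  shows "graded_ideal L (annihilator L I)"
proof -
  have L0: "lie_subalgebra L" using L by (simp add: graded_subalgebra_def)
  have Ic: "lie_ideal L I" "comp_closed I" using I by (auto simp: graded_ideal_iff[OF L])
  have "comp_closed (annihilator L I)"
    unfolding comp_closed_def
  proof (intro ballI allI)
    fix y \<sigma> assume y: "y \<in> annihilator L I"
    have "bracket x (hcomp y \<sigma>) = 0" if x: "x \<in> I" for x
    proof -
      have "bracket (hcomp x \<alpha>) (hcomp y \<sigma>) = 0" for \<alpha>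
      proof -
        have "bracket (hcomp x \<alpha>) y = 0"
          using x y Ic by (auto simp: comp_closed_def annihilator_def)
        then show ?thesis
          using comp_bracket_homogeneous_left[OF comp_in_Q, of x \<alpha> y \<sigma>] by simp
      qed
      then have "(\<Sum>\<alpha> | hcomp x \<alpha> \<noteq> 0. bracket (hcomp x \<alpha>) (hcomp y \<sigma>)) = 0" by simp
      then show ?thesis by (simp add: bracket_sum_left[symmetric] sum_comp)
    qed
    then show "hcomp y \<sigma> \<in> annihilator L I"
      using y comp_closed_subalgebra[OF L] by (auto simp: annihilator_def comp_closed_def)
  qed
  then show ?thesis
    using lie_ideal_annihilator[OF L0 Ic(1)] by (simp add: graded_ideal_iff[OF L])
qed

section \<open>From quotients to graded quotients\<close>

lemma ex_comp_bracket_nonzero: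
  assumes "bracket x p \<noteq> 0"
  shows "\<exists>\<alpha>. bracket (hcomp x \<alpha>) p \<noteq> 0"
  using assms bracket_sum_left[of "hcomp x" "{\<sigma>. hcomp x \<sigma> \<noteq> 0}" p]
  by (auto simp: sum_comp intro: ccontr)

lemma graded_algebra_of_quotients_if_algebra_of_quotients:
  assumes L: "graded_subalgebra L" and quot: "algebra_of_quotients L"
  shows "graded_algebra_of_quotients L"
  unfolding graded_algebra_of_quotients_def
proof (intro allI ballI impI)
  fix \<sigma> \<tau> p q assume q: "q \<in> Q \<tau>" and "p \<noteq> (0::'q)"
  then obtain x where x: "x \<in> colon L q" "bracket x p \<noteq> 0"
    using quot unfolding algebra_of_quotients_def colon_def by blast
  obtain \<alpha> where "bracket (hcomp x \<alpha>) p \<noteq> 0"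
    using ex_comp_bracket_nonzero[OF x(2)] by blast
  \<comment> \<open>Homogeneity of \<open>q\<close> makes the colon ideal graded, so the component
    is still an admissible witness.\<close>
  moreover have "hcomp x \<alpha> \<in> colon L q"
    using graded_ideal_colon[OF L q] x(1) by (simp add: graded_ideal_iff[OF L] comp_closed_def)
  ultimately show "\<exists>\<alpha>. \<exists>x\<in>L \<inter> Q \<alpha>. bracket x p \<noteq> 0 \<and> (\<forall>y\<in>ad_span L q. bracket x y \<in> L)"
    using comp_in_Q unfolding colon_def by blast
qed

section \<open>Dense graded ideals\<close>

definition dense_ideal :: "'q set \<Rightarrow> 'q set \<Rightarrow> bool" where
  "dense_ideal L I \<longleftrightarrow>
    graded_ideal L I \<and> (\<forall>\<sigma>. \<forall>p\<in>L \<inter> Q \<sigma>. p \<noteq> 0 \<longrightarrow> (\<exists>x\<in>I. bracket x p \<noteq> 0))"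

text \<open>With a homogeneous witness \<open>[x,p]\<close> is again homogeneous, so the density of
  a second ideal can be applied to it.\<close>

lemma dense_ideal_homogeneous:
  assumes L: "graded_subalgebra L" and I: "dense_ideal L I"
    and p: "p \<in> L \<inter> Q \<sigma>" "p \<noteq> 0"
  obtains \<alpha> x where "x \<in> I \<inter> Q \<alpha>" "bracket x p \<noteq> 0"
proof -
  obtain x where x: "x \<in> I" "bracket x p \<noteq> 0"
    using I p unfolding dense_ideal_def by blast
  obtain \<alpha> where "bracket (hcomp x \<alpha>) p \<noteq> 0"
    using ex_comp_bracket_nonzero[OF x(2)] by blast
  moreover have "hcomp x \<alpha> \<in> I \<inter> Q \<alpha>"
    using I x(1) comp_in_Q by (auto simp: dense_ideal_def graded_ideal_iff[OF L] comp_closed_def)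
  ultimately show thesis using that by blast
qed

text \<open>A nonzero homogeneous \<open>p\<close> annihilated by \<open>I \<inter> J\<close> would
  be moved by \<open>I\<close> and then by \<open>J\<close> to a nonzero element of
  \<open>I \<inter> J\<close> that still annihilates \<open>I \<inter> J\<close>; semiprimeness
  excludes such elements.\<close>

lemma dense_ideal_inter:
  assumes L: "graded_subalgebra L" and semiprime: "graded_semiprime L"
    and I: "dense_ideal L I" and J: "dense_ideal L J"
  shows "dense_ideal L (I \<inter> J)"
  unfolding dense_ideal_def
proof (intro conjI allI ballI impI)
  have gI: "graded_ideal L I" and gJ: "graded_ideal L J"
    using I J by (auto simp: dense_ideal_def)
  then show gIJ: "graded_ideal L (I \<inter> J)" by (rule graded_ideal_inter[OF L])
  define K where "K = annihilator L (I \<inter> J)"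
  have gK: "graded_ideal L K"
    unfolding K_def by (rule graded_ideal_annihilator[OF L gIJ])
  \<comment> \<open>\<open>K\<close> annihilates \<open>I \<inter> J\<close>, so the graded ideal
    \<open>K \<inter> (I \<inter> J)\<close> is abelian and hence zero.\<close>
  have "bracket_span (K \<inter> (I \<inter> J)) (K \<inter> (I \<inter> J)) = {0}"
    by (rule bracket_span_eq_zero) (auto simp: K_def annihilator_def)
  then have KIJ: "K \<inter> (I \<inter> J) = {0}"
    using semiprime graded_ideal_inter[OF L gK gIJ] unfolding graded_semiprime_def by blast
  fix \<sigma> p assume p: "p \<in> L \<inter> Q \<sigma>" "p \<noteq> 0"
  show "\<exists>x\<in>I \<inter> J. bracket x p \<noteq> 0"
  proof (rule ccontr)
    assume "\<not> ?thesis"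
    then have pK: "p \<in> K" using p by (auto simp: K_def annihilator_def)
    have ideals: "lie_ideal L I" "lie_ideal L J" "lie_ideal L K"
      using gI gJ gK by (auto simp: graded_ideal_iff[OF L])
    obtain \<alpha> x where x: "x \<in> I \<inter> Q \<alpha>" "bracket x p \<noteq> 0"
      using dense_ideal_homogeneous[OF L I p] .
    have xp: "bracket x p \<in> K \<inter> I" "bracket x p \<in> L \<inter> Q (\<alpha> + \<sigma>)"
      using x p pK ideals lie_ideal_bracket_right[OF ideals(1), of x p] bracket_graded[of x \<alpha> p \<sigma>]
      by (auto simp: lie_ideal_def)
    obtain y where y: "y \<in> J" "bracket y (bracket x p) \<noteq> 0"
      using J x(2) xp(2) unfolding dense_ideal_def by blast
    have "bracket y (bracket x p) \<in> K \<inter> (I \<inter> J)"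
      using y xp ideals lie_ideal_bracket_right[OF ideals(2), of y "bracket x p"]
      by (auto simp: lie_ideal_def)
    with KIJ y(2) show False by blast
  qed
qed

lemma dense_ideal_colon:
  assumes L: "graded_subalgebra L" and quot: "graded_algebra_of_quotients L" and q: "q \<in> Q \<tau>"
  shows "dense_ideal L (colon L q)"
  unfolding dense_ideal_def
proof (intro conjI graded_ideal_colon[OF L q] allI ballI impI)
  fix \<sigma> p assume "p \<in> L \<inter> Q \<sigma>" "p \<noteq> 0"
  then show "\<exists>x\<in>colon L q. bracket x p \<noteq> 0"
    using quot q unfolding graded_algebra_of_quotients_def colon_def by blast
qed

text \<open>\<open>L\<close> contains the ideal \<open>colon L 0\<close>, which is dense because 0
  is homogeneous.\<close>

lemma dense_ideal_self:
  assumes L: "graded_subalgebra L" and quot: "graded_algebra_of_quotients L"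
  shows "dense_ideal L L"
proof -
  have "graded_ideal L L"
    using L comp_closed_subalgebra[OF L] lie_ideal_self
    by (simp add: graded_ideal_iff[OF L] graded_subalgebra_def)
  moreover have "colon L q \<subseteq> L" for q by (auto simp: colon_def)
  ultimately show ?thesis
    using dense_ideal_colon[OF L quot subspace_0[OF subspace_Q]] unfolding dense_ideal_def
    by blast
qed

text \<open>The explicit factor \<open>L\<close> handles empty \<open>T\<close>, where the
  intersection of the family alone would be all of \<open>Q\<close>.\<close>

lemma dense_ideal_Inter_colon:
  assumes L: "graded_subalgebra L" and quot: "graded_algebra_of_quotients L"
    and semiprime: "graded_semiprime L" and "finite T"
  shows "dense_ideal L (L \<inter> (\<Inter>\<tau>\<in>T. colon L (hcomp q \<tau>)))"
  using \<open>finite T\<close>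
proof induction
  case empty
  then show ?case using dense_ideal_self[OF L quot] by simp
next
  case (insert \<tau> T)
  then show ?case
    using dense_ideal_inter[OF L semiprime dense_ideal_colon[OF L quot comp_in_Q[of q \<tau>]]]
    by (simp add: Int_left_commute[of L])
qed

text \<open>Density extends from homogeneous elements of \<open>L\<close> to all of
  \<open>Q\<close>: if \<open>I\<close> annihilates \<open>p\<close>, it annihilates a nonzero
  component of \<open>p\<close>, and (ii) moves that component to a nonzero homogeneous element of
  \<open>L\<close>.\<close>

lemma dense_ideal_bracket_nonzero:
  assumes L: "graded_subalgebra L" and quot: "graded_algebra_of_quotients L"
    and I: "dense_ideal L I" and "p \<noteq> 0"
  shows "\<exists>x\<in>I. bracket x p \<noteq> 0"
proof (rule ccontr)
  assume ann: "\<not> ?thesis"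
  have gI: "lie_ideal L I" "comp_closed I"
    using I by (auto simp: dense_ideal_def graded_ideal_iff[OF L])
  obtain \<sigma> where nz: "hcomp p \<sigma> \<noteq> 0"
    using \<open>p \<noteq> 0\<close> sum_comp[of p] by (metis (mono_tags, lifting) sum.neutral)
  have ann\<sigma>: "bracket (hcomp x \<alpha>) (hcomp p \<sigma>) = 0" if "x \<in> I" for x \<alpha>
  proof -
    have "bracket (hcomp x \<alpha>) p = 0" using that gI ann by (auto simp: comp_closed_def)
    then show ?thesis
      using comp_bracket_homogeneous_left[OF comp_in_Q, of x \<alpha> p \<sigma>] by simp
  qed
  have ann\<sigma>': "bracket x (hcomp p \<sigma>) = 0" if "x \<in> I" for x
    using ann\<sigma>[OF that] ex_comp_bracket_nonzero[of x "hcomp p \<sigma>"] by blast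
  \<comment> \<open>Condition (ii) with both elements equal to \<open>hcomp p \<sigma>\<close>:
    since this element lies in its own \<open>ad_span\<close>, the bracket with \<open>x\<close>
    lands in \<open>L\<close>.\<close>
  obtain \<alpha> x where x: "x \<in> L \<inter> Q \<alpha>" "bracket x (hcomp p \<sigma>) \<noteq> 0"
      "bracket x (hcomp p \<sigma>) \<in> L"
    using quot nz comp_in_Q[of p \<sigma>] ad_span_base[of "hcomp p \<sigma>" L]
    unfolding graded_algebra_of_quotients_def by blast
  moreover have "bracket x (hcomp p \<sigma>) \<in> Q (\<alpha> + \<sigma>)"
    using x(1) comp_in_Q by (auto intro: bracket_graded)
  ultimately obtain z where z: "z \<in> I" "bracket z (bracket x (hcomp p \<sigma>)) \<noteq> 0"
    using I unfolding dense_ideal_def by blast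
  \<comment> \<open>Both terms of
    \<open>[[z,x], hcomp p \<sigma>] + [x, [z, hcomp p \<sigma>]]\<close> vanish, as
    \<open>[z,x]\<close> and \<open>z\<close> lie in \<open>I\<close>.\<close>
  have "bracket z x \<in> I" using lie_ideal_bracket_right[OF gI(1)] z x by blast
  then show False
    using z(2) bracket_derivation[of z x "hcomp p \<sigma>"] ann\<sigma>' z(1) by simp
qed

section \<open>From graded quotients to quotients\<close>

lemma algebra_of_quotients_if_graded_algebra_of_quotients:
  assumes L: "graded_subalgebra L" and semiprime: "graded_semiprime L"
    and quot: "graded_algebra_of_quotients L"
  shows "algebra_of_quotients L"
  unfolding algebra_of_quotients_def
proof (intro allI impI)
  fix p q :: 'q assume "p \<noteq> 0"
  let ?T = "{\<tau>. hcomp q \<tau> \<noteq> 0}"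
  obtain x where x: "x \<in> L" "\<And>\<tau>. \<tau> \<in> ?T \<Longrightarrow> x \<in> colon L (hcomp q \<tau>)" "bracket x p \<noteq> 0"
    using dense_ideal_bracket_nonzero[OF L quot
        dense_ideal_Inter_colon[OF L quot semiprime finite_support] \<open>p \<noteq> 0\<close>] by blast
  \<comment> \<open>The components of \<open>q\<close> add up to \<open>q\<close>, so membership in
    their colon ideals gives membership in \<open>colon L q\<close>.\<close>
  have "x \<in> colon L (\<Sum>\<tau>\<in>?T. hcomp q \<tau>)"
    using L x by (intro colon_sum) (auto simp: graded_subalgebra_def)
  with x show "\<exists>x\<in>L. bracket x p \<noteq> 0 \<and> (\<forall>y\<in>ad_span L q. bracket x y \<in> L)"
    by (auto simp: sum_comp colon_def)
qed

end

theorem proposition2p7: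
  fixes scale :: "'r::comm_ring_1 \<Rightarrow> 'q::ab_group_add \<Rightarrow> 'q"
    and bracket :: "'q \<Rightarrow> 'q \<Rightarrow> 'q"
    and Q :: "'g::ab_group_add \<Rightarrow> 'q set"
    and L :: "'q set"
  assumes "graded_lie_algebra scale bracket Q"
    and "graded_lie_algebra.graded_subalgebra scale bracket Q L"
  shows "(lie_algebra.algebra_of_quotients scale bracket L \<longrightarrow>
            graded_lie_algebra.graded_algebra_of_quotients scale bracket Q L) \<and>
         (graded_lie_algebra.graded_semiprime scale bracket Q L \<longrightarrow>
            graded_lie_algebra.graded_algebra_of_quotients scale bracket Q L \<longrightarrow>
            lie_algebra.algebra_of_quotients scale bracket L)"
proof -
  interpret graded_lie_algebra scale bracket Q by (rule assms(1))
  show ?thesis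
    using assms(2) graded_algebra_of_quotients_if_algebra_of_quotients
      algebra_of_quotients_if_graded_algebra_of_quotients by blast
qed

end
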